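(* If $(x^*,z^* )$ is a global (respectively, local) vector solution of the set-valued formulation, then $x^*$ is a global (respectively, local) real optimistic solution of the bilevel problem, and there exists $y^*\in\psi(x^* )$ such that $(x^*,y^* )$ is a global (respectively, local) standard optimistic solution of the bilevel problem.
   Context: Setting. $\mathcal{X},\mathcal{Y}$ are real normed linear spaces, $X\subseteq\mathcal{X}$ is nonempty, $F:\mathcal{X}\times\mathcal{Y}\to\mathbb{R}$ is the upper-level objective. For each $x\in X$, $K(x)\subseteq\mathcal{Y}$ is the lower-level constraint set, $f$ is the real-valued lower-level objective, and $\psi(x)=\arg\min_y\{f(x,y)\mid y\in K(x)\}$ is the set of global minimizers of $f(x,\cdot)$ over $K(x)$. Standing assumption: $\psi(x)\neq\emptyset$ for every $x\in X$. The bilevel problem is: "minimize" over $x$ the value $F(x,y)$ subject to $x\in X$, $y\in\psi(x)$. $F_o(x)=\inf_{y\in\psi(x)}F(x,y)$ for $x\in X$ (possibly $-\infty$; attainment is not assumed). A point $x^*\in X$ is a global real optimistic solution of the bilevel problem if $F_o(x)\ge F_o(x^* )$ for all $x\in X$; it is a local real optimistic solution if there is $\epsilon>0$ such that $F_o(x)\ge F_o(x^* )$ for all $x\in X$ with $\|x-x^*\|<\epsilon$. A point $(x^*,y^* )$ with $x^*\in X$, $y^*\in\psi(x^* )$ is a global standard optimistic solution of the bilevel problem if $F(x,y)\ge F(x^*,y^* )$ for all $x\in X$, $y\in\psi(x)$; it is a local standard optimistic solution if there is $\epsilon>0$ such that $F(x,y)\ge F(x^*,y^* )$ for all $x\in X$,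 $y\in\psi(x)$ with $\|(x,y)-(x^*,y^* )\|<\epsilon$, where $\|(x,y)\|=\|x\|_{\mathcal{X}}+\|y\|_{\mathcal{Y}}$. Set-valued formulation: minimize $F(x,\psi(x))$ over $x\in X$, where $F(x,\psi(x)):=\{F(x,y)\mid y\in\psi(x)\}\subseteq\mathbb{R}$, with $\mathbb{R}$ carrying its usual order (induced by the cone $\mathbb{R}_+=[0,\infty)$). A pair $(x^0,z^0)\in X\times\mathbb{R}$ is a global vector solution of the set-valued formulation if $z^0\in F(x^0,\psi(x^0))$ and $z^0$ is a minimal element of $\bigcup_{x\in X}F(x,\psi(x))$; it is a local vector solution if $z^0\in F(x^0,\psi(x^0))$ and there is $\epsilon>0$ such that $z^0$ is a minimal element of $\bigcup_{x\in X,\ \|x-x^0\|<\epsilon}F(x,\psi(x))$. *)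

theory Defs
  imports "HOL-Analysis.Analysis"
begin

definition lower_solutions :: "('a \<Rightarrow> 'b \<Rightarrow> real) \<Rightarrow> ('a \<Rightarrow> 'b set) \<Rightarrow> 'a \<Rightarrow> 'b set" where
  "lower_solutions f K x = {y \<in> K x. \<forall>y' \<in> K x. f x y \<le> f x y'}"

text \<open>
  In the definitions below, \<open>\<psi>\<close> is the lower-level solution map. The optimistic value function is
  extended-real-valued, since the infimum over \<open>\<psi> x\<close> may be \<open>-\<infinity>\<close>.
\<close>

definition optimistic_value :: "('a \<Rightarrow> 'b \<Rightarrow> real) \<Rightarrow> ('a \<Rightarrow> 'b set) \<Rightarrow> 'a \<Rightarrow> ereal" where
  "optimistic_value F \<psi> x = (INF y \<in> \<psi> x. ereal (F x y))"

definition global_real_optimistic ::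
    "('a \<Rightarrow> 'b \<Rightarrow> real) \<Rightarrow> 'a set \<Rightarrow> ('a \<Rightarrow> 'b set) \<Rightarrow> 'a \<Rightarrow> bool" where
  "global_real_optimistic F X \<psi> xs \<longleftrightarrow>
     xs \<in> X \<and> (\<forall>x \<in> X. optimistic_value F \<psi> x \<ge> optimistic_value F \<psi> xs)"

definition local_real_optimistic ::
    "('a::real_normed_vector \<Rightarrow> 'b \<Rightarrow> real) \<Rightarrow> 'a set \<Rightarrow> ('a \<Rightarrow> 'b set) \<Rightarrow> 'a \<Rightarrow> bool" where
  "local_real_optimistic F X \<psi> xs \<longleftrightarrow>
     xs \<in> X \<and> (\<exists>\<epsilon>>0. \<forall>x \<in> X. norm (x - xs) < \<epsilon> \<longrightarrow>
       optimistic_value F \<psi> x \<ge> optimistic_value F \<psi> xs)"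

definition global_standard_optimistic ::
    "('a \<Rightarrow> 'b \<Rightarrow> real) \<Rightarrow> 'a set \<Rightarrow> ('a \<Rightarrow> 'b set) \<Rightarrow> 'a \<Rightarrow> 'b \<Rightarrow> bool" where
  "global_standard_optimistic F X \<psi> xs ys \<longleftrightarrow>
     xs \<in> X \<and> ys \<in> \<psi> xs \<and> (\<forall>x \<in> X. \<forall>y \<in> \<psi> x. F x y \<ge> F xs ys)"

text \<open>
  The product space carries the sum norm, which is not the norm of the library's product type;
  it is therefore written out.
\<close>

definition local_standard_optimistic ::
    "('a::real_normed_vector \<Rightarrow> 'b::real_normed_vector \<Rightarrow> real) \<Rightarrow> 'a set \<Rightarrow> ('a \<Rightarrow> 'b set)
      \<Rightarrow> 'a \<Rightarrow> 'b \<Rightarrow> bool" where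
  "local_standard_optimistic F X \<psi> xs ys \<longleftrightarrow>
     xs \<in> X \<and> ys \<in> \<psi> xs \<and>
     (\<exists>\<epsilon>>0. \<forall>x \<in> X. \<forall>y \<in> \<psi> x. norm (x - xs) + norm (y - ys) < \<epsilon> \<longrightarrow> F x y \<ge> F xs ys)"

definition minimal_element :: "'c::order \<Rightarrow> 'c set \<Rightarrow> bool" where
  "minimal_element z A \<longleftrightarrow> z \<in> A \<and> (\<forall>w \<in> A. w \<le> z \<longrightarrow> w = z)"

definition global_vector_solution ::
    "('a \<Rightarrow> 'b \<Rightarrow> real) \<Rightarrow> 'a set \<Rightarrow> ('a \<Rightarrow> 'b set) \<Rightarrow> 'a \<Rightarrow> real \<Rightarrow> bool" where
  "global_vector_solution F X \<psi> x0 z0 \<longleftrightarrow>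
     x0 \<in> X \<and> z0 \<in> F x0 ` \<psi> x0 \<and> minimal_element z0 (\<Union>x \<in> X. F x ` \<psi> x)"

definition local_vector_solution ::
    "('a::real_normed_vector \<Rightarrow> 'b \<Rightarrow> real) \<Rightarrow> 'a set \<Rightarrow> ('a \<Rightarrow> 'b set) \<Rightarrow> 'a \<Rightarrow> real \<Rightarrow> bool" where
  "local_vector_solution F X \<psi> x0 z0 \<longleftrightarrow>
     x0 \<in> X \<and> z0 \<in> F x0 ` \<psi> x0 \<and>
     (\<exists>\<epsilon>>0. minimal_element z0 (\<Union>x \<in> {x \<in> X. norm (x - x0) < \<epsilon>}. F x ` \<psi> x))"

end

theory Submission
  imports Defs
begin

text \<open>
  The order on the reals is total, so a minimal element \<open>z\<^sup>*\<close> of a union of image sets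
  \<open>F(x, \<psi>(x))\<close> is a lower bound of that union. Any \<open>y\<^sup>* \<in> \<psi>(x\<^sup>*)\<close> with \<open>z\<^sup>* = F(x\<^sup>*, y\<^sup>*)\<close>
  therefore minimizes \<open>F\<close> over all feasible pairs whose first component lies in the region of
  \<open>x\<close> under consideration. Optimality of \<open>(x\<^sup>*, y\<^sup>*)\<close> is then immediate, and so is that of
  \<open>x\<^sup>*\<close>: the value \<open>F\<^sub>o(x\<^sup>*) \<le> F(x\<^sup>*, y\<^sup>*)\<close> lies below every \<open>F(x, y)\<close>, hence below every
  infimum \<open>F\<^sub>o(x)\<close>.

  The global and the local case differ only in the region, which is \<open>X\<close> or its part within
  distance \<open>\<epsilon>\<close> of \<open>x\<^sup>*\<close>. In the local case the same \<open>\<epsilon>\<close> serves for pairs, since the sum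
  norm dominates the norm of the first component.
\<close>

lemma minimal_element_iff_least:
  fixes z :: "'c::linorder"
  shows "minimal_element z A \<longleftrightarrow> z \<in> A \<and> (\<forall>w \<in> A. z \<le> w)"
  unfolding minimal_element_def by (metis linorder_le_cases order.antisym)

text \<open>
  A value \<open>F xs ys\<close> that bounds \<open>F x\<close> from below on \<open>\<psi> x\<close> separates the two infima, whether
  or not either of them is attained or finite.
\<close>

lemma optimistic_value_le:
  assumes "ys \<in> \<psi> xs" and "\<And>y. y \<in> \<psi> x \<Longrightarrow> F xs ys \<le> F x y"
  shows "optimistic_value F \<psi> xs \<le> optimistic_value F \<psi> x"
proof -
  have "optimistic_value F \<psi> xs \<le> ereal (F xs ys)"
    unfolding optimistic_value_def using assms(1) by (rule INF_lower)
  also have "\<dots> \<le> optimistic_value F \<psi> x"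
    unfolding optimistic_value_def using assms(2) by (auto intro: INF_greatest)
  finally show ?thesis .
qed

lemma global_vector_solution_imp_optimistic:
  assumes "global_vector_solution F X \<psi> xs zs"
  shows "global_real_optimistic F X \<psi> xs \<and>
         (\<exists>ys \<in> \<psi> xs. global_standard_optimistic F X \<psi> xs ys)"
proof -
  obtain ys where xs: "xs \<in> X" and ys: "ys \<in> \<psi> xs" and zs: "zs = F xs ys"
    using assms unfolding global_vector_solution_def by blast
  have least: "F xs ys \<le> F x y" if "x \<in> X" "y \<in> \<psi> x" for x y
    using assms that zs unfolding global_vector_solution_def minimal_element_iff_least by auto
  have value_le: "optimistic_value F \<psi> xs \<le> optimistic_value F \<psi> x" if "x \<in> X" for x
    using ys least that by (intro optimistic_value_le) auto
  have "global_real_optimistic F X \<psi> xs"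
    unfolding global_real_optimistic_def using xs value_le by blast
  moreover have "global_standard_optimistic F X \<psi> xs ys"
    unfolding global_standard_optimistic_def using xs ys least by blast
  ultimately show ?thesis
    using ys by blast
qed

lemma local_vector_solution_imp_optimistic:
  fixes F :: "'a::real_normed_vector \<Rightarrow> 'b::real_normed_vector \<Rightarrow> real"
  assumes "local_vector_solution F X \<psi> xs zs"
  shows "local_real_optimistic F X \<psi> xs \<and>
         (\<exists>ys \<in> \<psi> xs. local_standard_optimistic F X \<psi> xs ys)"
proof -
  obtain ys \<epsilon> where xs: "xs \<in> X" and ys: "ys \<in> \<psi> xs" and zs: "zs = F xs ys" and "\<epsilon> > 0"
    and min: "minimal_element zs (\<Union>x \<in> {x \<in> X. norm (x - xs) < \<epsilon>}. F x ` \<psi> x)"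
    using assms unfolding local_vector_solution_def by blast
  have least: "F xs ys \<le> F x y" if "x \<in> X" "norm (x - xs) < \<epsilon>" "y \<in> \<psi> x" for x y
    using min that zs unfolding minimal_element_iff_least by auto
  have value_le: "optimistic_value F \<psi> xs \<le> optimistic_value F \<psi> x"
    if "x \<in> X" "norm (x - xs) < \<epsilon>" for x
    using ys least that by (intro optimistic_value_le) auto
  have "local_real_optimistic F X \<psi> xs"
    unfolding local_real_optimistic_def
    using xs value_le \<open>\<epsilon> > 0\<close> by blast
  moreover have "local_standard_optimistic F X \<psi> xs ys"
  proof -
    have "F xs ys \<le> F x y"
      if "x \<in> X" "y \<in> \<psi> x" "norm (x - xs) + norm (y - ys) < \<epsilon>" for x y
    proof (rule least)
      show "norm (x - xs) < \<epsilon>"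
        using that(3) norm_ge_zero[of "y - ys"] by linarith
    qed (use that in auto)
    then show ?thesis
      unfolding local_standard_optimistic_def using xs ys \<open>\<epsilon> > 0\<close> by blast
  qed
  ultimately show ?thesis
    using ys by blast
qed

theorem proposition12:
  fixes F f :: "'a::real_normed_vector \<Rightarrow> 'b::real_normed_vector \<Rightarrow> real"
    and K :: "'a \<Rightarrow> 'b set"
    and X :: "'a set"
    and xs :: 'a and zs :: real
  defines "\<psi> \<equiv> lower_solutions f K"
  assumes "X \<noteq> {}"
    and "\<And>x. x \<in> X \<Longrightarrow> \<psi> x \<noteq> {}"
  shows "(global_vector_solution F X \<psi> xs zs \<longrightarrow>
            global_real_optimistic F X \<psi> xs \<and>
            (\<exists>ys \<in> \<psi> xs. global_standard_optimistic F X \<psi> xs ys)) \<and>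
         (local_vector_solution F X \<psi> xs zs \<longrightarrow>
            local_real_optimistic F X \<psi> xs \<and>
            (\<exists>ys \<in> \<psi> xs. local_standard_optimistic F X \<psi> xs ys))"
proof (rule conjI; rule impI)
  assume "global_vector_solution F X \<psi> xs zs"
  then show "global_real_optimistic F X \<psi> xs \<and>
             (\<exists>ys \<in> \<psi> xs. global_standard_optimistic F X \<psi> xs ys)"
    by (rule global_vector_solution_imp_optimistic)
next
  assume "local_vector_solution F X \<psi> xs zs"
  then show "local_real_optimistic F X \<psi> xs \<and>
             (\<exists>ys \<in> \<psi> xs. local_standard_optimistic F X \<psi> xs ys)"
    by (rule local_vector_solution_imp_optimistic)
qed

end
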